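(* Fix a staggered mesh with periodic boundary conditions, $\Delta t>0$ and constants $c_0,c_h\in\mathbb{R}$, $\tau\in(0,+\infty]$, and let $(T_p^n,\mathbf{J}_c^n,\boldsymbol{\psi}_p^n,\varphi_c^n)_{n\ge0}$ satisfy the scheme $$T_p^{n+1}=T_p^n-c_0\Delta t\,\nabla_p^c\cdot\mathbf{J}_c^{n+\frac12},$$ $$\mathbf{J}_c^{n+1}=\mathbf{J}_c^n-c_0\Delta t\,\nabla_c^pT_p^{n+\frac12}-c_h\Delta t\,\nabla_c^p\times\boldsymbol{\psi}_p^{n+\frac12}-\frac{\Delta t}{\tau}\mathbf{J}_c^{n+\frac12},$$ $$\boldsymbol{\psi}_p^{n+1}=\boldsymbol{\psi}_p^n+c_h\Delta t\,\nabla_p^c\times\mathbf{J}_c^{n+\frac12}-c_h\Delta t\,\nabla_p^c\varphi_c^{n+\frac12},$$ $$\varphi_c^{n+1}=\varphi_c^n-c_h\Delta t\,\nabla_c^p\cdot\boldsymbol{\psi}_p^{n+\frac12}.$$ Then the discrete wave invariant $$\mathrm{E}_\varphi^n=\frac12\sum_p|\Omega_p|\,\big\|\nabla_p^c\varphi_c^n\big\|^2+\frac12\sum_c|\Omega_c|\,\big|\nabla_c^p\cdot\boldsymbol{\psi}_p^n\big|^2$$ is exactly conserved, both for the reversible scheme ($1/\tau=0$) and for the dissipative scheme ($0<\tau<+\infty$): $\mathrm{E}_\varphi^n=\mathrm{E}_\varphi^0$ for all $n\ge0$.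
   Context: Staggered mesh: the domain $\Omega$ is covered by finitely many primal cells $\Omega_c$ (indexed by $c$, centers $\mathbf{x}_c$) and by dual cells $\Omega_p$ (indexed by the primal vertices $p$, centers $\mathbf{x}_p$) obtained by connecting neighboring primal cell centers; $|\Omega_c|,|\Omega_p|>0$ are their measures. Write $p\in\Omega_c$ iff $p$ is a vertex of $\Omega_c$; this is equivalent to $c\in\Omega_p$. With periodic boundary conditions the mesh is identified periodically and there are no boundary contributions. For each incident pair $(c,p)$, $l_{pc}\mathbf{n}_{pc}$ is the corner vector: the integral of the unit normal outward to $\Omega_c$ over the part of $\partial\Omega_c$ consisting of the half-edges of $\Omega_c$ adjacent to $p$ (viewed as a vector in $\mathbb{R}^3$, with vanishing third component for two-dimensional meshes), with $l_{pc}\ge0$, and $\mathbf{n}_{cp}=-\mathbf{n}_{pc}$. One has $\sum_{p\in\Omega_c}l_{pc}\mathbf{n}_{pc}=0$ and $\sum_{c\in\Omega_p}l_{pc}\mathbf{n}_{cp}=0$. Discrete operators, for $\star$ denoting multiplication by a scalar field (gradient), scalar product $\cdot$ with a vector field (divergence), or vector product $\times$ with a vector field (curl): $$(\nabla_c^p\star f_p)_c=\frac1{|\Omega_c|}\sum_{p\in\Omega_c}l_{pc}\mathbf{n}_{pc}\star f_p,\qquad(\nabla_p^c\star f_c)_p=\frac1{|\Omega_p|}\sum_{c\in\Omega_p}l_{pc}\mathbf{n}_{cp}\star f_c.$$ The meshes considered are such that the compatibility identities $\nabla_c^p\times\nabla_p^c\phi_c=0$, $\nabla_p^c\times\nabla_c^p\phi_p=0$,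 $\nabla_c^p\cdot(\nabla_p^c\times\mathbf{A}_c)=0$, $\nabla_p^c\cdot(\nabla_c^p\times\mathbf{A}_p)=0$ hold for all discrete fields (e.g. uniform Cartesian periodic meshes). Unknowns: $T_p^n\in\mathbb{R}$ and $\boldsymbol{\psi}_p^n\in\mathbb{R}^3$ live at the vertices $p$; $\mathbf{J}_c^n\in\mathbb{R}^3$ and $\varphi_c^n\in\mathbb{R}$ live at the cell centers $c$. A superscript $n+\frac12$ denotes the average of the values at $n$ and $n+1$. $\tau=+\infty$ ($1/\tau=0$) means the relaxation term is dropped (reversible scheme). $\|\cdot\|$ is the Euclidean norm. *)

theory Defs
  imports "HOL-Analysis.Analysis"
begin

text \<open>
  The mesh carries its geometry measure-theoretically. The periodic domain (for instance a flat
  torus) is a measure space with its volume measure, so that there is no outer boundary and no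
  quotient has to be formed. The boundary of a primal cell is a measure space of its own, with the
  surface (in two dimensions: length) measure and the outward unit normal field. It is kept apart
  from the domain because on a coarse periodic mesh two sides of one cell may be identified, and
  they then carry opposite normals at the same point. Normals of two-dimensional meshes have
  vanishing third component.
\<close>

record ('x, 'b, 'c, 'p) mesh =
  domain :: "'x measure"
  cells :: "'c set"
  verts :: "'p set"
  cell_center :: "'c \<Rightarrow> 'x"
  vert_pos :: "'p \<Rightarrow> 'x"
  primal_cell :: "'c \<Rightarrow> 'x set"
  dual_cell :: "'p \<Rightarrow> 'x set"
  verts_of :: "'c \<Rightarrow> 'p set"              \<comment> \<open>the \<open>p\<close> with \<open>p \<in> \<Omega>\<^sub>c\<close>\<close>
  cells_of :: "'p \<Rightarrow> 'c set"              \<comment> \<open>the \<open>c\<close> with \<open>c \<in> \<Omega>\<^sub>p\<close>\<close>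
  boundary :: "'c \<Rightarrow> 'b measure"          \<comment> \<open>surface measure on the boundary of \<open>\<Omega>\<^sub>c\<close>\<close>
  outer_normal :: "'c \<Rightarrow> 'b \<Rightarrow> real^3"
  half_edges :: "'c \<Rightarrow> 'p \<Rightarrow> 'b set"       \<comment> \<open>half-edges of \<open>\<Omega>\<^sub>c\<close> adjacent to \<open>p\<close>\<close>
  corner_len :: "'p \<Rightarrow> 'c \<Rightarrow> real"        \<comment> \<open>\<open>l\<^bsub>pc\<^esub>\<close>\<close>
  normal_pc :: "'p \<Rightarrow> 'c \<Rightarrow> real^3"       \<comment> \<open>\<open>n\<^bsub>pc\<^esub>\<close>\<close>

definition vol_c :: "('x, 'b, 'c, 'p) mesh \<Rightarrow> 'c \<Rightarrow> real" where
  "vol_c m c = measure (domain m) (primal_cell m c)"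

definition vol_p :: "('x, 'b, 'c, 'p) mesh \<Rightarrow> 'p \<Rightarrow> real" where
  "vol_p m p = measure (domain m) (dual_cell m p)"

definition normal_cp :: "('x, 'b, 'c, 'p) mesh \<Rightarrow> 'c \<Rightarrow> 'p \<Rightarrow> real^3" where
  "normal_cp m c p = - normal_pc m p c"

text \<open>
  The last two assumptions, closedness of the corner vectors around primal and dual cells, express
  that the normal integrates to zero over a closed boundary and that the half-edges meeting at a
  vertex are each shared by two cells with opposite normals.
\<close>

locale staggered_mesh =
  fixes m :: "('x, 'b, 'c, 'p) mesh"
  assumes finite_cells: "finite (cells m)"
    and finite_verts: "finite (verts m)"
    and verts_eq: "verts m = (\<Union>c\<in>cells m. verts_of m c)"
    and cells_of_subset: "p \<in> verts m \<Longrightarrow> cells_of m p \<subseteq> cells m"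
    and incidence: "c \<in> cells m \<Longrightarrow> p \<in> verts m \<Longrightarrow> p \<in> verts_of m c \<longleftrightarrow> c \<in> cells_of m p"
    and primal_sets: "c \<in> cells m \<Longrightarrow> primal_cell m c \<in> sets (domain m)"
    and dual_sets: "p \<in> verts m \<Longrightarrow> dual_cell m p \<in> sets (domain m)"
    and primal_cover: "(\<Union>c\<in>cells m. primal_cell m c) = space (domain m)"
    and dual_cover: "(\<Union>p\<in>verts m. dual_cell m p) = space (domain m)"
    and primal_overlap: "\<lbrakk>c \<in> cells m; c' \<in> cells m; c \<noteq> c'\<rbrakk>
      \<Longrightarrow> primal_cell m c \<inter> primal_cell m c' \<in> null_sets (domain m)"
    and dual_overlap: "\<lbrakk>p \<in> verts m; p' \<in> verts m; p \<noteq> p'\<rbrakk>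
      \<Longrightarrow> dual_cell m p \<inter> dual_cell m p' \<in> null_sets (domain m)"
    and vert_in_primal: "c \<in> cells m \<Longrightarrow> p \<in> verts_of m c \<Longrightarrow> vert_pos m p \<in> primal_cell m c"
    and center_in_dual: "p \<in> verts m \<Longrightarrow> c \<in> cells_of m p \<Longrightarrow> cell_center m c \<in> dual_cell m p"
    and vol_c_pos: "c \<in> cells m \<Longrightarrow> vol_c m c > 0"
    and vol_p_pos: "p \<in> verts m \<Longrightarrow> vol_p m p > 0"
    and boundary_finite: "c \<in> cells m \<Longrightarrow> finite_measure (boundary m c)"
    and outer_normal_measurable:
      "c \<in> cells m \<Longrightarrow> outer_normal m c \<in> borel_measurable (boundary m c)"
    and outer_normal_unit:
      "c \<in> cells m \<Longrightarrow> b \<in> space (boundary m c) \<Longrightarrow> norm (outer_normal m c b) = 1"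
    and half_edges_sets:
      "c \<in> cells m \<Longrightarrow> p \<in> verts_of m c \<Longrightarrow> half_edges m c p \<in> sets (boundary m c)"
    and half_edges_cover:
      "c \<in> cells m \<Longrightarrow> (\<Union>p\<in>verts_of m c. half_edges m c p) = space (boundary m c)"
    and half_edges_overlap:
      "\<lbrakk>c \<in> cells m; p \<in> verts_of m c; p' \<in> verts_of m c; p \<noteq> p'\<rbrakk>
      \<Longrightarrow> half_edges m c p \<inter> half_edges m c p' \<in> null_sets (boundary m c)"
    and corner_len_nonneg: "c \<in> cells m \<Longrightarrow> p \<in> verts_of m c \<Longrightarrow> corner_len m p c \<ge> 0"
    and corner_vector: "c \<in> cells m \<Longrightarrow> p \<in> verts_of m c \<Longrightarrow>
      corner_len m p c *\<^sub>R normal_pc m p c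
        = (LINT b:half_edges m c p|boundary m c. outer_normal m c b)"
    and primal_closed: "c \<in> cells m \<Longrightarrow>
      (\<Sum>p\<in>verts_of m c. corner_len m p c *\<^sub>R normal_pc m p c) = 0"
    and dual_closed: "p \<in> verts m \<Longrightarrow>
      (\<Sum>c\<in>cells_of m p. corner_len m p c *\<^sub>R normal_cp m c p) = 0"

definition nabla_cp ::
    "('x, 'b, 'c, 'p) mesh \<Rightarrow> (real^3 \<Rightarrow> 'f \<Rightarrow> 'g::real_vector) \<Rightarrow> ('p \<Rightarrow> 'f) \<Rightarrow> 'c \<Rightarrow> 'g" where
  "nabla_cp m star f c = (1 / vol_c m c) *\<^sub>R
     (\<Sum>p\<in>verts_of m c. star (corner_len m p c *\<^sub>R normal_pc m p c) (f p))"

definition nabla_pc ::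
    "('x, 'b, 'c, 'p) mesh \<Rightarrow> (real^3 \<Rightarrow> 'f \<Rightarrow> 'g::real_vector) \<Rightarrow> ('c \<Rightarrow> 'f) \<Rightarrow> 'p \<Rightarrow> 'g" where
  "nabla_pc m star f p = (1 / vol_p m p) *\<^sub>R
     (\<Sum>c\<in>cells_of m p. star (corner_len m p c *\<^sub>R normal_cp m c p) (f c))"

abbreviation grad_cp :: "('x, 'b, 'c, 'p) mesh \<Rightarrow> ('p \<Rightarrow> real) \<Rightarrow> 'c \<Rightarrow> real^3" where
  "grad_cp m \<equiv> nabla_cp m (\<lambda>v s. s *\<^sub>R v)"

abbreviation div_cp :: "('x, 'b, 'c, 'p) mesh \<Rightarrow> ('p \<Rightarrow> real^3) \<Rightarrow> 'c \<Rightarrow> real" where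
  "div_cp m \<equiv> nabla_cp m inner"

abbreviation curl_cp :: "('x, 'b, 'c, 'p) mesh \<Rightarrow> ('p \<Rightarrow> real^3) \<Rightarrow> 'c \<Rightarrow> real^3" where
  "curl_cp m \<equiv> nabla_cp m cross3"

abbreviation grad_pc :: "('x, 'b, 'c, 'p) mesh \<Rightarrow> ('c \<Rightarrow> real) \<Rightarrow> 'p \<Rightarrow> real^3" where
  "grad_pc m \<equiv> nabla_pc m (\<lambda>v s. s *\<^sub>R v)"

abbreviation div_pc :: "('x, 'b, 'c, 'p) mesh \<Rightarrow> ('c \<Rightarrow> real^3) \<Rightarrow> 'p \<Rightarrow> real" where
  "div_pc m \<equiv> nabla_pc m inner"

abbreviation curl_pc :: "('x, 'b, 'c, 'p) mesh \<Rightarrow> ('c \<Rightarrow> real^3) \<Rightarrow> 'p \<Rightarrow> real^3" where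
  "curl_pc m \<equiv> nabla_pc m cross3"

locale compatible_staggered_mesh = staggered_mesh m
  for m :: "('x, 'b, 'c, 'p) mesh" +
  assumes curl_grad_c: "c \<in> cells m \<Longrightarrow> curl_cp m (grad_pc m \<phi>) c = 0"
    and curl_grad_p: "p \<in> verts m \<Longrightarrow> curl_pc m (grad_cp m \<theta>) p = 0"
    and div_curl_c: "c \<in> cells m \<Longrightarrow> div_cp m (curl_pc m A) c = 0"
    and div_curl_p: "p \<in> verts m \<Longrightarrow> div_pc m (curl_cp m B) p = 0"

definition half_step :: "(nat \<Rightarrow> 'i \<Rightarrow> 'v::real_vector) \<Rightarrow> nat \<Rightarrow> 'i \<Rightarrow> 'v" where
  "half_step u n i = (1 / 2) *\<^sub>R (u n i + u (Suc n) i)"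

text \<open>
  With \<open>\<tau> = \<infinity>\<close> the coefficient of the relaxation term is \<open>0\<close>, which gives the reversible scheme.
\<close>

definition wave_scheme ::
    "('x, 'b, 'c, 'p) mesh \<Rightarrow> real \<Rightarrow> real \<Rightarrow> real \<Rightarrow> ereal \<Rightarrow> (nat \<Rightarrow> 'p \<Rightarrow> real) \<Rightarrow>
     (nat \<Rightarrow> 'c \<Rightarrow> real^3) \<Rightarrow> (nat \<Rightarrow> 'p \<Rightarrow> real^3) \<Rightarrow> (nat \<Rightarrow> 'c \<Rightarrow> real) \<Rightarrow> bool" where
  "wave_scheme m dt c0 ch \<tau> T J \<psi> \<phi> \<longleftrightarrow>
     (\<forall>n. \<forall>p\<in>verts m.
        T (Suc n) p = T n p - c0 * dt * div_pc m (half_step J n) p) \<and>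
     (\<forall>n. \<forall>c\<in>cells m.
        J (Suc n) c = J n c - (c0 * dt) *\<^sub>R grad_cp m (half_step T n) c
          - (ch * dt) *\<^sub>R curl_cp m (half_step \<psi> n) c
          - real_of_ereal (ereal dt / \<tau>) *\<^sub>R half_step J n c) \<and>
     (\<forall>n. \<forall>p\<in>verts m.
        \<psi> (Suc n) p = \<psi> n p + (ch * dt) *\<^sub>R curl_pc m (half_step J n) p
          - (ch * dt) *\<^sub>R grad_pc m (half_step \<phi> n) p) \<and>
     (\<forall>n. \<forall>c\<in>cells m.
        \<phi> (Suc n) c = \<phi> n c - ch * dt * div_cp m (half_step \<psi> n) c)"

definition wave_invariant ::
    "('x, 'b, 'c, 'p) mesh \<Rightarrow> ('c \<Rightarrow> real) \<Rightarrow> ('p \<Rightarrow> real^3) \<Rightarrow> real" where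
  "wave_invariant m \<phi> \<psi> =
     1 / 2 * (\<Sum>p\<in>verts m. vol_p m p * (norm (grad_pc m \<phi> p))\<^sup>2)
     + 1 / 2 * (\<Sum>c\<in>cells m. vol_c m c * \<bar>div_cp m \<psi> c\<bar>\<^sup>2)"

end

theory Submission
  imports Defs
begin

text \<open>
  Put \<open>k = c\<^sub>h \<Delta>t\<close>, \<open>G = \<nabla>\<^sub>p\<^sup>c \<phi>\<close> and \<open>D = \<nabla>\<^sub>c\<^sup>p \<cdot> \<psi>\<close>. Since the divergence of
  a curl vanishes, \<open>J\<close> drops out of the equation for \<open>D\<close>, and the pair \<open>(G, D)\<close> evolves by
  \<open>G' - G = -k \<nabla>\<^sub>p\<^sup>c D\<^sub>h\<close> and \<open>D' - D = -k \<nabla>\<^sub>c\<^sup>p \<cdot> G\<^sub>h\<close>, where \<open>G\<^sub>h\<close> and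
  \<open>D\<^sub>h\<close> are the averages over the step. As \<open>\<parallel>G'\<parallel>\<^sup>2 - \<parallel>G\<parallel>\<^sup>2 = 2 G\<^sub>h \<bullet> (G' - G)\<close>, and likewise
  for \<open>D\<close>, the change of the invariant is \<open>-k\<close> times
  \<open>\<Sum>\<^sub>p |\<Omega>\<^sub>p| G\<^sub>h \<bullet> \<nabla>\<^sub>p\<^sup>c D\<^sub>h + \<Sum>\<^sub>c |\<Omega>\<^sub>c| D\<^sub>h (\<nabla>\<^sub>c\<^sup>p \<cdot> G\<^sub>h)\<close>, which is zero by
  summation by parts.
\<close>

lemma nabla_cp_add:
  assumes "bounded_bilinear star"
  shows "nabla_cp m star (\<lambda>p. f p + g p) c = nabla_cp m star f c + nabla_cp m star g c"
  by (simp add: nabla_cp_def bounded_bilinear.add_right[OF assms] sum.distrib scaleR_add_right)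

lemma nabla_pc_add:
  assumes "bounded_bilinear star"
  shows "nabla_pc m star (\<lambda>c. f c + g c) p = nabla_pc m star f p + nabla_pc m star g p"
  by (simp add: nabla_pc_def bounded_bilinear.add_right[OF assms] sum.distrib scaleR_add_right)

lemma nabla_cp_scaleR:
  assumes "bounded_bilinear star"
  shows "nabla_cp m star (\<lambda>p. a *\<^sub>R f p) c = a *\<^sub>R nabla_cp m star f c"
  by (simp add: nabla_cp_def bounded_bilinear.scaleR_right[OF assms] scaleR_sum_right mult.commute)

lemma nabla_pc_scaleR:
  assumes "bounded_bilinear star"
  shows "nabla_pc m star (\<lambda>c. a *\<^sub>R f c) p = a *\<^sub>R nabla_pc m star f p"
  by (simp add: nabla_pc_def bounded_bilinear.scaleR_right[OF assms] scaleR_sum_right mult.commute)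

lemma nabla_cp_half_step:
  assumes "bounded_bilinear star"
  shows "nabla_cp m star (half_step u n) c
    = (1 / 2) *\<^sub>R (nabla_cp m star (u n) c + nabla_cp m star (u (Suc n)) c)"
  unfolding half_step_def nabla_cp_scaleR[OF assms] nabla_cp_add[OF assms] ..

lemma nabla_pc_half_step:
  assumes "bounded_bilinear star"
  shows "nabla_pc m star (half_step u n) p
    = (1 / 2) *\<^sub>R (nabla_pc m star (u n) p + nabla_pc m star (u (Suc n)) p)"
  unfolding half_step_def nabla_pc_scaleR[OF assms] nabla_pc_add[OF assms] ..

text \<open>In the gradient the corner vector comes first and the scalar field second, hence the
  flip.\<close>

lemmas bounded_bilinear_gradient = bounded_bilinear.flip[OF bounded_bilinear_scaleR]

context staggered_mesh
begin

lemma verts_of_subset: "c \<in> cells m \<Longrightarrow> verts_of m c \<subseteq> verts m"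
  using verts_eq by auto

text \<open>The scheme fixes the new fields only on the mesh. This suffices because the stencil of a
  cell stays inside \<open>verts m\<close>.\<close>

lemma nabla_cp_cong:
  assumes "c \<in> cells m" and "\<And>p. p \<in> verts m \<Longrightarrow> f p = g p"
  shows "nabla_cp m star f c = nabla_cp m star g c"
proof -
  have "f p = g p" if "p \<in> verts_of m c" for p
    using that assms verts_of_subset by blast
  then show ?thesis
    by (simp add: nabla_cp_def)
qed

lemma nabla_pc_cong:
  assumes "p \<in> verts m" and "\<And>c. c \<in> cells m \<Longrightarrow> f c = g c"
  shows "nabla_pc m star f p = nabla_pc m star g p"
proof -
  have "f c = g c" if "c \<in> cells_of m p" for c
    using that assms cells_of_subset by blast
  then show ?thesis
    by (simp add: nabla_pc_def)
qed

text \<open>Both sides run over the same set of incident pairs, since \<open>p\<close> is a vertex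
  of \<open>c\<close> exactly when \<open>c\<close> belongs to the dual cell of
  \<open>p\<close>.\<close>

lemma sum_incident_swap:
  "(\<Sum>p\<in>verts m. \<Sum>c\<in>cells_of m p. f p c) = (\<Sum>c\<in>cells m. \<Sum>p\<in>verts_of m c. f p c)"
proof -
  have "cells_of m p = {c \<in> cells m. p \<in> verts_of m c}" if "p \<in> verts m" for p
    using that cells_of_subset incidence by blast
  moreover have "verts_of m c = {p \<in> verts m. p \<in> verts_of m c}" if "c \<in> cells m" for c
    using that verts_of_subset by blast
  ultimately show ?thesis
    using sum.swap_restrict[OF finite_verts finite_cells, of f "\<lambda>p c. p \<in> verts_of m c"] by simp
qed

text \<open>The positive volumes cancel the prefactors of the operators. What remains on either side
  is a sum over incident pairs, and the minus sign comes from \<open>normal_cp\<close> being the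
  negative of \<open>normal_pc\<close>.\<close>

lemma summation_by_parts:
  "(\<Sum>p\<in>verts m. vol_p m p * (u p \<bullet> grad_pc m s p))
    = - (\<Sum>c\<in>cells m. vol_c m c * (s c * div_cp m u c))"
proof -
  have "vol_p m p * (u p \<bullet> grad_pc m s p)
      = (\<Sum>c\<in>cells_of m p. - (s c * ((corner_len m p c *\<^sub>R normal_pc m p c) \<bullet> u p)))"
    if "p \<in> verts m" for p
    using vol_p_pos[OF that]
    by (simp add: nabla_pc_def normal_cp_def inner_sum_right inner_commute sum_negf algebra_simps)
  moreover have "vol_c m c * (s c * div_cp m u c)
      = (\<Sum>p\<in>verts_of m c. s c * ((corner_len m p c *\<^sub>R normal_pc m p c) \<bullet> u p))"
    if "c \<in> cells m" for c
    using vol_c_pos[OF that] by (simp add: nabla_cp_def sum_distrib_left)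
  ultimately show ?thesis
    by (simp add: sum_incident_swap sum_negf)
qed

end

lemma inner_half_sum_diff:
  "((1 / 2) *\<^sub>R (x + y)) \<bullet> (y - x) = 1 / 2 * (norm y)\<^sup>2 - 1 / 2 * (norm (x::'a::real_inner))\<^sup>2"
  by (simp add: power2_norm_eq_inner inner_simps inner_commute)

lemma weighted_sum_diff:
  fixes f g h w :: "'i \<Rightarrow> 'a::comm_ring"
  assumes "\<And>i. i \<in> A \<Longrightarrow> a * f i - a * g i = k * h i"
  shows "a * (\<Sum>i\<in>A. w i * f i) - a * (\<Sum>i\<in>A. w i * g i) = k * (\<Sum>i\<in>A. w i * h i)"
proof -
  have "a * (w i * f i) - a * (w i * g i) = k * (w i * h i)" if "i \<in> A" for i
    using arg_cong[OF assms[OF that], of "(*) (w i)"] by (simp add: algebra_simps)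
  then show ?thesis
    by (simp add: sum_distrib_left flip: sum_subtractf)
qed

lemma (in compatible_staggered_mesh) wave_invariant_Suc:
  assumes scheme: "wave_scheme m dt c0 ch \<tau> T J \<psi> \<phi>"
  shows "wave_invariant m (\<phi> (Suc n)) (\<psi> (Suc n)) = wave_invariant m (\<phi> n) (\<psi> n)"
proof -
  define k where "k = ch * dt"
  define G where "G = grad_pc m (half_step \<phi> n)"
  define D where "D = div_cp m (half_step \<psi> n)"
  \<comment> \<open>Written with sums and scalings only, so that additivity and homogeneity of the
    operators apply directly.\<close>
  have psi: "\<psi> (Suc n) p = \<psi> n p + (k *\<^sub>R curl_pc m (half_step J n) p + (- k) *\<^sub>R G p)"
    if "p \<in> verts m" for p
    using scheme that by (simp add: wave_scheme_def k_def G_def)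
  have phi: "\<phi> (Suc n) c = \<phi> n c + (- k) *\<^sub>R D c" if "c \<in> cells m" for c
    using scheme that by (simp add: wave_scheme_def k_def D_def)
  have grad_step: "grad_pc m (\<phi> (Suc n)) p - grad_pc m (\<phi> n) p = (- k) *\<^sub>R grad_pc m D p"
    if "p \<in> verts m" for p
  proof -
    have "grad_pc m (\<phi> (Suc n)) p = grad_pc m (\<lambda>c. \<phi> n c + (- k) *\<^sub>R D c) p"
      using that phi by (rule nabla_pc_cong)
    also have "\<dots> = grad_pc m (\<phi> n) p + (- k) *\<^sub>R grad_pc m D p"
      by (simp only: nabla_pc_add[OF bounded_bilinear_gradient]
          nabla_pc_scaleR[OF bounded_bilinear_gradient])
    finally show ?thesis by simp
  qed
  have div_step: "div_cp m (\<psi> (Suc n)) c - div_cp m (\<psi> n) c = (- k) *\<^sub>R div_cp m G c"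
    if "c \<in> cells m" for c
  proof -
    have "div_cp m (\<psi> (Suc n)) c
        = div_cp m (\<lambda>p. \<psi> n p + (k *\<^sub>R curl_pc m (half_step J n) p + (- k) *\<^sub>R G p)) c"
      using that psi by (rule nabla_cp_cong)
    also have "\<dots> = div_cp m (\<psi> n) c
        + (k *\<^sub>R div_cp m (curl_pc m (half_step J n)) c + (- k) *\<^sub>R div_cp m G c)"
      by (simp only: nabla_cp_add[OF bounded_bilinear_inner]
          nabla_cp_scaleR[OF bounded_bilinear_inner])
    \<comment> \<open>The coupling to \<open>J\<close> vanishes here, and with it any effect of
      relaxation, so one argument covers every \<open>\<tau>\<close>.\<close>
    finally show ?thesis by (simp add: div_curl_c[OF that])
  qed
  have "1 / 2 * (norm (grad_pc m (\<phi> (Suc n)) p))\<^sup>2 - 1 / 2 * (norm (grad_pc m (\<phi> n) p))\<^sup>2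
      = - k * (G p \<bullet> grad_pc m D p)" if "p \<in> verts m" for p
    \<comment> \<open>By linearity \<open>G\<close> is the mean of the old and new gradients, which
      is the first factor in the factored difference of squares.\<close>
    unfolding inner_half_sum_diff[symmetric] grad_step[OF that] G_def
      nabla_pc_half_step[OF bounded_bilinear_gradient] by simp
  then have grad_sum: "1 / 2 * (\<Sum>p\<in>verts m. vol_p m p * (norm (grad_pc m (\<phi> (Suc n)) p))\<^sup>2)
      - 1 / 2 * (\<Sum>p\<in>verts m. vol_p m p * (norm (grad_pc m (\<phi> n) p))\<^sup>2)
      = - k * (\<Sum>p\<in>verts m. vol_p m p * (G p \<bullet> grad_pc m D p))"
    by (rule weighted_sum_diff)
  have "1 / 2 * \<bar>div_cp m (\<psi> (Suc n)) c\<bar>\<^sup>2 - 1 / 2 * \<bar>div_cp m (\<psi> n) c\<bar>\<^sup>2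
      = - k * (D c * div_cp m G c)" if "c \<in> cells m" for c
    \<comment> \<open>Reading the absolute value as the norm of the reals makes the same
      factorization apply.\<close>
    unfolding real_norm_def[symmetric] inner_half_sum_diff[symmetric] div_step[OF that] D_def
      nabla_cp_half_step[OF bounded_bilinear_inner] by simp
  then have div_sum: "1 / 2 * (\<Sum>c\<in>cells m. vol_c m c * \<bar>div_cp m (\<psi> (Suc n)) c\<bar>\<^sup>2)
      - 1 / 2 * (\<Sum>c\<in>cells m. vol_c m c * \<bar>div_cp m (\<psi> n) c\<bar>\<^sup>2)
      = - k * (\<Sum>c\<in>cells m. vol_c m c * (D c * div_cp m G c))"
    by (rule weighted_sum_diff)
  show ?thesis
    using grad_sum div_sum summation_by_parts[of G D] by (simp add: wave_invariant_def)
qed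

theorem theorem4p5:
  fixes m :: "('x, 'b, 'c, 'p) mesh"
    and dt c0 ch :: real and \<tau> :: ereal
    and T :: "nat \<Rightarrow> 'p \<Rightarrow> real" and J :: "nat \<Rightarrow> 'c \<Rightarrow> real^3"
    and \<psi> :: "nat \<Rightarrow> 'p \<Rightarrow> real^3" and \<phi> :: "nat \<Rightarrow> 'c \<Rightarrow> real"
  assumes "compatible_staggered_mesh m"
    and "dt > 0" and "0 < \<tau>"
    and "wave_scheme m dt c0 ch \<tau> T J \<psi> \<phi>"
  shows "\<forall>n. wave_invariant m (\<phi> n) (\<psi> n) = wave_invariant m (\<phi> 0) (\<psi> 0)"
proof
  fix n
  show "wave_invariant m (\<phi> n) (\<psi> n) = wave_invariant m (\<phi> 0) (\<psi> 0)"
    by (induction n)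
      (simp_all add: compatible_staggered_mesh.wave_invariant_Suc[OF assms(1,4)])
qed

end
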